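(* Let $n\ge 1$, let $\mathbf m=(m_1,\dots,m_n)$ and $\mathbf M=(M_1,\dots,M_n)$ be vectors of $\mathbb R^n$ whose components are arranged in nonincreasing order, with $0\le m_i\le M_i$ for all $i=1,\dots,n$, and let $a>0$ be a real number with $\sum_{i=1}^n m_i\le a\le \sum_{i=1}^n M_i$. Let $$S_a=\Big\{\mathbf x\in\mathbb R^n:\ x_1\ge x_2\ge\dots\ge x_n\ge 0,\ \sum_{i=1}^n x_i=a,\ m_i\le x_i\le M_i \text{ for } i=1,\dots,n\Big\}.$$ Let $k\ge 0$ be the smallest integer such that $$\sum_{i=1}^{k}M_i+\sum_{i=k+1}^{n}m_i\ \le\ a\ <\ \sum_{i=1}^{k+1}M_i+\sum_{i=k+2}^{n}m_i ,$$ and put $\theta=a-\sum_{i=1}^{k}M_i-\sum_{i=k+2}^{n}m_i$. Then the maximal element of $S_a$ with respect to the majorization order is $$\mathbf x^*(S_a)=(M_1,\dots,M_k,\ \theta,\ m_{k+2},\dots,m_n),$$ i.e. this vector belongs to $S_a$ and $\mathbf x\trianglelefteq \mathbf x^*(S_a)$ for every $\mathbf x\in S_a$.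
   Context: For vectors $\mathbf x,\mathbf y\in\mathbb R^n$ with components arranged in nonincreasing order, the majorization order $\mathbf x\trianglelefteq\mathbf y$ means $\sum_{i=1}^j x_i\le\sum_{i=1}^j y_i$ for $j=1,\dots,n-1$ and $\sum_{i=1}^n x_i=\sum_{i=1}^n y_i$. The maximal element $\mathbf x^*(S)$ of a set $S$ is the element of $S$ with $\mathbf x\trianglelefteq\mathbf x^*(S)$ for all $\mathbf x\in S$. Empty sums are $0$.
   Formalization: When a equals the sum of all M_i, no integer k satisfies the displayed inequalities; here k = n is then allowed, with the strict upper bound dropped, and the maximal element is (M_1,…,M_n). For every smaller a, k is exactly as stated. *)

theory Defs
  imports "Jordan_Normal_Form.Matrix"
begin

text \<open>Vectors of \<open>\<real>\<^sup>n\<close> are the elements of \<open>carrier_vec n\<close>. Indices start at 0, so the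
  component \<open>x\<^sub>i\<close> of the mathematical text is \<open>x $ (i - 1)\<close>, and a sum over
  \<open>1 \<le> i \<le> k\<close> becomes a sum over \<open>i < k\<close>.\<close>

definition nonincreasing :: "real vec \<Rightarrow> bool" where
  "nonincreasing x \<longleftrightarrow> antimono_on {..<dim_vec x} (($) x)"

text \<open>Majorization is a relation between nonincreasing vectors of the same dimension only.\<close>

definition majorized :: "nat \<Rightarrow> real vec \<Rightarrow> real vec \<Rightarrow> bool" where
  "majorized n x y \<longleftrightarrow>
     x \<in> carrier_vec n \<and> y \<in> carrier_vec n \<and> nonincreasing x \<and> nonincreasing y \<and>
     (\<forall>j\<in>{1..n - 1}. (\<Sum>i<j. x $ i) \<le> (\<Sum>i<j. y $ i)) \<and>
     (\<Sum>i<n. x $ i) = (\<Sum>i<n. y $ i)"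

definition is_maximal_element :: "nat \<Rightarrow> real vec set \<Rightarrow> real vec \<Rightarrow> bool" where
  "is_maximal_element n S y \<longleftrightarrow> y \<in> S \<and> (\<forall>x\<in>S. majorized n x y)"

definition S_set :: "nat \<Rightarrow> real vec \<Rightarrow> real vec \<Rightarrow> real \<Rightarrow> real vec set" where
  "S_set n m M a = {x \<in> carrier_vec n.
     nonincreasing x \<and> 0 \<le> x $ (n - 1) \<and> (\<Sum>i<n. x $ i) = a \<and>
     (\<forall>i<n. m $ i \<le> x $ i \<and> x $ i \<le> M $ i)}"

text \<open>The strict upper bound for \<open>k\<close> involves the component \<open>M\<^sub>k\<^sub>+\<^sub>1\<close>, which does not exist for
  \<open>k = n\<close>; it is then dropped. The value \<open>k = n\<close> occurs exactly when \<open>a\<close> is the sum of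
  all components of \<open>M\<close> (given that \<open>a\<close> does not exceed this sum), where no \<open>k < n\<close>
  satisfies the strict bound.\<close>

definition critical_index :: "nat \<Rightarrow> real vec \<Rightarrow> real vec \<Rightarrow> real \<Rightarrow> nat \<Rightarrow> bool" where
  "critical_index n m M a k \<longleftrightarrow> k \<le> n \<and>
     (\<Sum>i<k. M $ i) + (\<Sum>i=k..<n. m $ i) \<le> a \<and>
     (k < n \<longrightarrow> a < (\<Sum>i<k + 1. M $ i) + (\<Sum>i=k + 1..<n. m $ i))"

end

theory Submission
  imports Defs
begin

text \<open>A partial sum of length at most \<open>k\<close> of the candidate vector uses only upper bounds, and the
  complementary tail of a longer one uses only lower bounds. With the total fixed to \<open>a\<close>, both
  make the partial sum the largest possible one.\<close>

lemma nonincreasing_iff: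
  "nonincreasing x \<longleftrightarrow> (\<forall>i j. i \<le> j \<longrightarrow> j < dim_vec x \<longrightarrow> x $ j \<le> x $ i)"
  by (auto simp: nonincreasing_def monotone_on_def)

lemma sum_lessThan_split:
  fixes f :: "nat \<Rightarrow> real"
  assumes "j \<le> n"
  shows "(\<Sum>i<n. f i) = (\<Sum>i<j. f i) + (\<Sum>i=j..<n. f i)"
  using assms sum.atLeastLessThan_concat[of 0 j n f] by (simp add: atLeast0LessThan)

text \<open>The lower bound holds at \<open>0\<close> by hypothesis, and only indices up to
  \<open>n\<close> are considered, so a greatest index satisfying it exists. Its failure one step
  later is the strict upper bound. This existence is what makes the \<open>LEAST\<close> in the
  theorem meaningful.\<close>

lemma critical_index_exists:
  assumes "(\<Sum>i<n. m $ i) \<le> a"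
  shows "\<exists>k. critical_index n m M a k"
proof -
  define P where
    "P k \<longleftrightarrow> k \<le> n \<and> (\<Sum>i<k. M $ i) + (\<Sum>i=k..<n. m $ i) \<le> a" for k
  define k where "k = (GREATEST k. P k)"
  have P0: "P 0"
    using assms by (simp add: P_def atLeast0LessThan)
  have bound: "\<And>y. P y \<Longrightarrow> y \<le> n"
    by (simp add: P_def)
  have "P k"
    unfolding k_def using P0 bound by (rule GreatestI_nat)
  \<comment> \<open>For \<open>k = n\<close> this failure comes only from
    \<open>k + 1 \<le> n\<close> being false, in agreement with the guard \<open>k < n\<close> on
    the strict bound.\<close>
  moreover have "\<not> P (k + 1)"
    using Greatest_le_nat[of P "k + 1" n] bound by (auto simp: k_def)
  ultimately have "critical_index n m M a k"
    unfolding critical_index_def P_def by auto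
  then show ?thesis ..
qed

text \<open>Stated for an arbitrary critical index; the theorem instantiates it with the least
  one.\<close>

lemma maximal_element_if_critical:
  fixes n k :: nat and m M :: "real vec" and a \<theta> :: real
  assumes n: "n \<ge> 1"
    and dim: "m \<in> carrier_vec n" "M \<in> carrier_vec n"
    and mono: "nonincreasing m" "nonincreasing M"
    and mM: "\<forall>i<n. 0 \<le> m $ i \<and> m $ i \<le> M $ i"
    and aM: "a \<le> (\<Sum>i<n. M $ i)"
    and crit: "critical_index n m M a k"
    and \<theta>: "\<theta> = a - (\<Sum>i<k. M $ i) - (\<Sum>i=k + 1..<n. m $ i)"
  shows "is_maximal_element n (S_set n m M a)
           (vec n (\<lambda>i. if i < k then M $ i else if i = k then \<theta> else m $ i))"
proof -
  define y where "y = vec n (\<lambda>i. if i < k then M $ i else if i = k then \<theta> else m $ i)"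
  have y_carrier: "y \<in> carrier_vec n"
    by (simp add: y_def)
  have y_less: "y $ i = M $ i" if "i < k" "i < n" for i
    using that by (simp add: y_def)
  have y_greater: "y $ i = m $ i" if "k < i" "i < n" for i
    using that by (simp add: y_def)
  have y_k: "y $ k = \<theta>" if "k < n"
    using that by (simp add: y_def)
  have kn: "k \<le> n" and lower: "(\<Sum>i<k. M $ i) + (\<Sum>i=k..<n. m $ i) \<le> a"
    and upper: "k < n \<Longrightarrow> a < (\<Sum>i<k + 1. M $ i) + (\<Sum>i=k + 1..<n. m $ i)"
    using crit by (auto simp: critical_index_def)
  \<comment> \<open>Once the term at index \<open>k\<close> is split off, the two inequalities
    defining a critical index read \<open>m $ k \<le> \<theta>\<close> and
    \<open>\<theta> < M $ k\<close>.\<close>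
  have \<theta>_bounds: "m $ k \<le> \<theta> \<and> \<theta> \<le> M $ k" if "k < n"
    using lower upper[OF that] \<theta> that by (simp add: sum.atLeast_Suc_lessThan)
  have y_bounds: "m $ i \<le> y $ i \<and> y $ i \<le> M $ i" if "i < n" for i
    using that mM \<theta>_bounds y_less y_greater y_k by (cases i k rule: linorder_cases) auto
  have y_prefix: "(\<Sum>i<j. y $ i) = (\<Sum>i<j. M $ i)" if "j \<le> k" for j
    using that kn by (intro sum.cong) (auto intro: y_less)
  have y_suffix: "(\<Sum>i=j..<n. y $ i) = (\<Sum>i=j..<n. m $ i)" if "k < j" for j
    using that by (intro sum.cong) (auto intro: y_greater)
  have y_sum: "(\<Sum>i<n. y $ i) = a"
  proof (cases "k < n")
    case True
    then have "(\<Sum>i<n. y $ i) = (\<Sum>i<k. y $ i) + y $ k + (\<Sum>i=k + 1..<n. y $ i)"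
      by (simp add: sum_lessThan_split[of k n] sum.atLeast_Suc_lessThan)
    then show ?thesis
      using True y_prefix[of k] y_suffix[of "k + 1"] y_k \<theta> by simp
  next
    \<comment> \<open>Here \<open>k = n\<close>, so \<open>y\<close> agrees with \<open>M\<close> in
      every component, and \<open>lower\<close> together with \<open>aM\<close> forces the
      components of \<open>M\<close> to sum to \<open>a\<close>.\<close>
    case False
    then show ?thesis
      using kn lower aM y_prefix[of k] by simp
  qed
  have y_mono: "nonincreasing y"
    unfolding nonincreasing_iff
  proof (intro allI impI)
    fix i j
    assume "i \<le> j" "j < dim_vec y"
    then have ij: "i \<le> j" "j < n" "i < n"
      using y_carrier by auto
    then have le: "m $ j \<le> m $ i" "M $ j \<le> M $ i"
      using mono dim by (auto simp: nonincreasing_iff)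
    \<comment> \<open>If neither of the first two cases holds, then
      \<open>k \<le> i \<le> j \<le> k\<close>. In the first,
      \<open>y $ j = m $ j \<le> m $ i \<le> y $ i\<close>; in the second,
      \<open>y $ j \<le> M $ j \<le> M $ i = y $ i\<close>. No comparison of \<theta> with its
      neighbours is needed beyond the bounds on \<open>y\<close>.\<close>
    consider "k < j" | "i < k" | "i = j"
      using \<open>i \<le> j\<close> by linarith
    then show "y $ j \<le> y $ i"
    proof cases
      case 1
      then show ?thesis using le y_greater[of j] y_bounds[of i] ij by simp
    next
      case 2
      then show ?thesis using le y_less[of i] y_bounds[of j] ij by simp
    qed simp
  qed
  \<comment> \<open>Since \<open>n \<ge> 1\<close>, the index \<open>n - 1\<close> is a valid one,
    so the lower bound by \<open>m\<close> applies there.\<close>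
  have "0 \<le> y $ (n - 1)"
    using y_bounds[of "n - 1"] mM[rule_format, of "n - 1"] n by simp
  then have "y \<in> S_set n m M a"
    using y_carrier y_mono y_sum y_bounds by (simp add: S_set_def)
  moreover have "majorized n x y" if "x \<in> S_set n m M a" for x
  proof -
    have x: "x \<in> carrier_vec n" "nonincreasing x" "(\<Sum>i<n. x $ i) = a"
      "\<And>i. i < n \<Longrightarrow> m $ i \<le> x $ i" "\<And>i. i < n \<Longrightarrow> x $ i \<le> M $ i"
      using that by (auto simp: S_set_def)
    have "(\<Sum>i<j. x $ i) \<le> (\<Sum>i<j. y $ i)" if "j \<le> n" for j
    proof (cases "j \<le> k")
      case True
      have "(\<Sum>i<j. x $ i) \<le> (\<Sum>i<j. M $ i)"
        using that by (intro sum_mono x(5)) auto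
      then show ?thesis
        using y_prefix[OF True] by simp
    next
      case False
      have "(\<Sum>i=j..<n. m $ i) \<le> (\<Sum>i=j..<n. x $ i)"
        by (intro sum_mono x(4)) auto
      then show ?thesis
        using y_suffix[of j] False y_sum x(3) sum_lessThan_split[OF that, of "($) x"]
          sum_lessThan_split[OF that, of "($) y"] by simp
    qed
    then show ?thesis
      unfolding majorized_def using x y_carrier y_mono y_sum by auto
  qed
  ultimately show ?thesis
    unfolding is_maximal_element_def y_def by blast
qed

theorem theorem2:
  fixes n k :: nat and m M :: "real vec" and a \<theta> :: real
  assumes "n \<ge> 1"
    and "m \<in> carrier_vec n" and "M \<in> carrier_vec n"
    and "nonincreasing m" and "nonincreasing M"
    and "\<forall>i<n. 0 \<le> m $ i \<and> m $ i \<le> M $ i"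
    and "a > 0"
    and "(\<Sum>i<n. m $ i) \<le> a" and "a \<le> (\<Sum>i<n. M $ i)"
    and "k = (LEAST k. critical_index n m M a k)"
    and "\<theta> = a - (\<Sum>i<k. M $ i) - (\<Sum>i=k + 1..<n. m $ i)"
  shows "is_maximal_element n (S_set n m M a)
           (vec n (\<lambda>i. if i < k then M $ i else if i = k then \<theta> else m $ i))"
proof (rule maximal_element_if_critical)
  show "critical_index n m M a k"
    unfolding assms(10) using critical_index_exists[OF assms(8)] by (rule LeastI_ex)
qed (use assms in simp_all)

end
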